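(* Every graphed semigroupoid $(\mathcal{S}^{(0)},\mathcal{S},\mathfrak{s},\mathfrak{r},\mu)$ is categorical (i.e. the Exel semigroupoid $(\mathcal{S},\mathcal{S}^{(2)},\mu)$ is categorical). Conversely, every categorical Exel semigroupoid $(\Lambda,\Lambda^{[2]},\mu)$ can be graphed, i.e. there exist a set $\Lambda^{(0)}$ and maps $\mathfrak{s},\mathfrak{r}\colon\Lambda\to\Lambda^{(0)}$ such that $\Lambda^{[2]}=\Lambda^{(2)}$ and $(\Lambda^{(0)},\Lambda,\mathfrak{s},\mathfrak{r},\mu)$ is a graphed semigroupoid.
   Context: An Exel semigroupoid is a set $\Lambda$ with a subset $\Lambda^{[2]}\subseteq\Lambda\times\Lambda$ and a product $\mu\colon\Lambda^{[2]}\to\Lambda$, $\mu(f,g)=fg$, such that for all $f,g,h\in\Lambda$ the statements (i) $(f,g)\in\Lambda^{[2]}$ and $(g,h)\in\Lambda^{[2]}$; (ii) $(f,g)\in\Lambda^{[2]}$ and $(fg,h)\in\Lambda^{[2]}$; (iii) $(g,h)\in\Lambda^{[2]}$ and $(f,gh)\in\Lambda^{[2]}$ are equivalent, and if they hold then $(fg)h=f(gh)$. A graph consists of a vertex set $G^{(0)}$, an arrow set $G$ and maps $\mathfrak{s},\mathfrak{r}\colon G\to G^{(0)}$ (source and range); $G^{(2)}=\{(a,b)\in G\times G:\mathfrak{s}(a)=\mathfrak{r}(b)\}$ and $G^{(3)}=\{(a,b,c):\mathfrak{s}(a)=\mathfrak{r}(b),\ \mathfrak{s}(b)=\mathfrak{r}(c)\}$.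 A graphed semigroupoid is a tuple $(\mathcal{S}^{(0)},\mathcal{S},\mathfrak{s},\mathfrak{r},\mu)$ where $(\mathcal{S}^{(0)},\mathcal{S},\mathfrak{s},\mathfrak{r})$ is a graph with $\mathcal{S}^{(0)}=\mathfrak{s}(\mathcal{S})\cup\mathfrak{r}(\mathcal{S})$ and $\mu\colon\mathcal{S}^{(2)}\to\mathcal{S}$, $\mu(a,b)=ab$, satisfies $\mathfrak{s}(ab)=\mathfrak{s}(b)$, $\mathfrak{r}(ab)=\mathfrak{r}(a)$ for all $(a,b)\in\mathcal{S}^{(2)}$, and $(ab)c=a(bc)$ for all $(a,b,c)\in\mathcal{S}^{(3)}$. Every graphed semigroupoid is an Exel semigroupoid with $\mathcal{S}^{[2]}=\mathcal{S}^{(2)}$. For $a$ in an Exel semigroupoid $\Lambda$ let $\Lambda^a=\{b\in\Lambda:(a,b)\in\Lambda^{[2]}\}$. $\Lambda$ is categorical if for all $a,b\in\Lambda$ the sets $\Lambda^a$ and $\Lambda^b$ are either disjoint or equal. *)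

theory Defs
  imports "HOL-Library.FuncSet"
begin

text \<open>
  Sets are carriers inside arbitrary types.  A partially defined product is given by a total
  binary operation; only its values on composable pairs are ever constrained or used.
\<close>

locale exel_semigroupoid =
  fixes \<Lambda> :: "'a set"
    and D :: "('a \<times> 'a) set"  \<comment> \<open>the set \<open>\<Lambda>\<^sup>[\<^sup>2\<^sup>]\<close> of composable pairs\<close>
    and mult :: "'a \<Rightarrow> 'a \<Rightarrow> 'a"  (infixl "\<odot>" 70)
  assumes D_subset: "D \<subseteq> \<Lambda> \<times> \<Lambda>"
    and mult_closed: "(f, g) \<in> D \<Longrightarrow> f \<odot> g \<in> \<Lambda>"
    and composable_iff_left:
      "\<lbrakk>f \<in> \<Lambda>; g \<in> \<Lambda>; h \<in> \<Lambda>\<rbrakk> \<Longrightarrow>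
        ((f, g) \<in> D \<and> (g, h) \<in> D) \<longleftrightarrow> ((f, g) \<in> D \<and> (f \<odot> g, h) \<in> D)"
    and composable_iff_right:
      "\<lbrakk>f \<in> \<Lambda>; g \<in> \<Lambda>; h \<in> \<Lambda>\<rbrakk> \<Longrightarrow>
        ((f, g) \<in> D \<and> (g, h) \<in> D) \<longleftrightarrow> ((g, h) \<in> D \<and> (f, g \<odot> h) \<in> D)"
    and mult_assoc:
      "\<lbrakk>f \<in> \<Lambda>; g \<in> \<Lambda>; h \<in> \<Lambda>; (f, g) \<in> D; (g, h) \<in> D\<rbrakk> \<Longrightarrow>
        (f \<odot> g) \<odot> h = f \<odot> (g \<odot> h)"

definition right_composable :: "'a set \<Rightarrow> ('a \<times> 'a) set \<Rightarrow> 'a \<Rightarrow> 'a set" where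
  "right_composable \<Lambda> D a = {b \<in> \<Lambda>. (a, b) \<in> D}"

definition categorical :: "'a set \<Rightarrow> ('a \<times> 'a) set \<Rightarrow> bool" where
  "categorical \<Lambda> D \<longleftrightarrow>
    (\<forall>a\<in>\<Lambda>. \<forall>b\<in>\<Lambda>. right_composable \<Lambda> D a \<inter> right_composable \<Lambda> D b = {} \<or>
      right_composable \<Lambda> D a = right_composable \<Lambda> D b)"

locale arrow_graph =
  fixes V :: "'v set" and G :: "'a set" and src :: "'a \<Rightarrow> 'v" and rng :: "'a \<Rightarrow> 'v"
  assumes src_closed: "src \<in> G \<rightarrow> V"
    and rng_closed: "rng \<in> G \<rightarrow> V"

definition composable_pairs :: "'a set \<Rightarrow> ('a \<Rightarrow> 'v) \<Rightarrow> ('a \<Rightarrow> 'v) \<Rightarrow> ('a \<times> 'a) set" where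
  "composable_pairs G src rng = {(a, b) \<in> G \<times> G. src a = rng b}"

definition composable_triples ::
    "'a set \<Rightarrow> ('a \<Rightarrow> 'v) \<Rightarrow> ('a \<Rightarrow> 'v) \<Rightarrow> ('a \<times> 'a \<times> 'a) set" where
  "composable_triples G src rng =
    {(a, b, c) \<in> G \<times> G \<times> G. src a = rng b \<and> src b = rng c}"

locale graphed_semigroupoid = arrow_graph V S src rng
  for V :: "'v set" and S :: "'a set" and src :: "'a \<Rightarrow> 'v" and rng :: "'a \<Rightarrow> 'v" +
  fixes mult :: "'a \<Rightarrow> 'a \<Rightarrow> 'a"  (infixl "\<odot>" 70)
  assumes vertices: "V = src ` S \<union> rng ` S"
    and mult_closed: "(a, b) \<in> composable_pairs S src rng \<Longrightarrow> a \<odot> b \<in> S"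
    and src_mult: "(a, b) \<in> composable_pairs S src rng \<Longrightarrow> src (a \<odot> b) = src b"
    and rng_mult: "(a, b) \<in> composable_pairs S src rng \<Longrightarrow> rng (a \<odot> b) = rng a"
    and mult_assoc:
      "(a, b, c) \<in> composable_triples S src rng \<Longrightarrow> (a \<odot> b) \<odot> c = a \<odot> (b \<odot> c)"

end

theory Submission imports Defs begin

text \<open>
  In a graphed semigroupoid the arrows composable with \<open>a\<close> on the right are those whose
  range is the source of \<open>a\<close>, so these sets are fibres of the range map, and fibres of a map
  are disjoint or equal.

  Conversely, in a categorical Exel semigroupoid the vertices are chosen to be sets of
  arrows.  The source of \<open>a\<close> is \<open>\<Lambda>\<^sup>a\<close>.  The range of \<open>b\<close> ought to be the unique \<open>\<Lambda>\<^sup>a\<close> that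
  contains \<open>b\<close>, but there may be no such \<open>a\<close>; then the range has to differ from every source.
  Both requirements are met by one formula, the class of all arrows with the same left
  partners as \<open>b\<close>.  If \<open>b \<in> \<Lambda>\<^sup>a\<close>, categoricity makes this class equal to \<open>\<Lambda>\<^sup>a\<close>.
  In any case the class contains \<open>b\<close>, so it can equal \<open>\<Lambda>\<^sup>a\<close> only if \<open>b \<in> \<Lambda>\<^sup>a\<close>.  That the source and
  range of a product are the expected ones is the equivalence of the three composability
  conditions of an Exel semigroupoid.
\<close>

lemma right_composable_composable_pairs:
  assumes "a \<in> S"
  shows "right_composable S (composable_pairs S src rng) a = {b \<in> S. rng b = src a}"
  using assms by (auto simp: right_composable_def composable_pairs_def)

lemma categorical_composable_pairs: "categorical S (composable_pairs S src rng)"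
  by (auto simp: categorical_def right_composable_composable_pairs)

lemma (in graphed_semigroupoid) exel_semigroupoid_composable_pairs:
  "exel_semigroupoid S (composable_pairs S src rng) mult"
proof
  show "composable_pairs S src rng \<subseteq> S \<times> S"
    by (auto simp: composable_pairs_def)
next
  fix f g assume "(f, g) \<in> composable_pairs S src rng"
  then show "f \<odot> g \<in> S" by (rule mult_closed)
next
  fix f g h assume "f \<in> S" "g \<in> S" "h \<in> S"
  then show "((f, g) \<in> composable_pairs S src rng \<and> (g, h) \<in> composable_pairs S src rng) \<longleftrightarrow>
      ((f, g) \<in> composable_pairs S src rng \<and> (f \<odot> g, h) \<in> composable_pairs S src rng)"
    using mult_closed[of f g] src_mult[of f g] by (auto simp: composable_pairs_def)
next
  fix f g h assume "f \<in> S" "g \<in> S" "h \<in> S"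
  then show "((f, g) \<in> composable_pairs S src rng \<and> (g, h) \<in> composable_pairs S src rng) \<longleftrightarrow>
      ((g, h) \<in> composable_pairs S src rng \<and> (f, g \<odot> h) \<in> composable_pairs S src rng)"
    using mult_closed[of g h] rng_mult[of g h] by (auto simp: composable_pairs_def)
next
  fix f g h assume "f \<in> S" "g \<in> S" "h \<in> S"
    "(f, g) \<in> composable_pairs S src rng" "(g, h) \<in> composable_pairs S src rng"
  then show "(f \<odot> g) \<odot> h = f \<odot> (g \<odot> h)"
    by (intro mult_assoc) (auto simp: composable_pairs_def composable_triples_def)
qed

definition same_left_partners :: "'a set \<Rightarrow> ('a \<times> 'a) set \<Rightarrow> 'a \<Rightarrow> 'a set" where
  "same_left_partners \<Lambda> D b = {c \<in> \<Lambda>. \<forall>a\<in>\<Lambda>. (a, c) \<in> D \<longleftrightarrow> (a, b) \<in> D}"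

lemma same_left_partners_self: "b \<in> \<Lambda> \<Longrightarrow> b \<in> same_left_partners \<Lambda> D b"
  by (simp add: same_left_partners_def)

text \<open>
  Two sets \<open>\<Lambda>\<^sup>a\<close> and \<open>\<Lambda>\<^sup>x\<close> that meet in \<open>b\<close> coincide, so all members of \<open>\<Lambda>\<^sup>a\<close> have the left
  partners of \<open>b\<close>; and an arrow with the left partners of \<open>b\<close> has in particular \<open>a\<close> among them.
\<close>

lemma right_composable_eq_same_left_partners:
  assumes "categorical \<Lambda> D" "a \<in> \<Lambda>" "b \<in> \<Lambda>" "(a, b) \<in> D"
  shows "right_composable \<Lambda> D a = same_left_partners \<Lambda> D b"
proof -
  have "(x, c) \<in> D \<longleftrightarrow> (x, b) \<in> D" if "x \<in> \<Lambda>" "c \<in> \<Lambda>" "(a, c) \<in> D" for x c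
  proof -
    have "right_composable \<Lambda> D a \<inter> right_composable \<Lambda> D x = {} \<or>
        right_composable \<Lambda> D a = right_composable \<Lambda> D x"
      using assms(1,2) that(1) by (auto simp: categorical_def)
    then show ?thesis
      using assms(3,4) that by (auto simp: right_composable_def set_eq_iff)
  qed
  then show ?thesis
    using assms(2,4) by (auto simp: right_composable_def same_left_partners_def)
qed

lemma composable_pairs_same_left_partners:
  assumes "categorical \<Lambda> D" "D \<subseteq> \<Lambda> \<times> \<Lambda>"
  shows "composable_pairs \<Lambda> (right_composable \<Lambda> D) (same_left_partners \<Lambda> D) = D"
proof -
  have "right_composable \<Lambda> D a = same_left_partners \<Lambda> D b \<longleftrightarrow> (a, b) \<in> D"
    if "a \<in> \<Lambda>" "b \<in> \<Lambda>" for a b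
  proof
    assume "right_composable \<Lambda> D a = same_left_partners \<Lambda> D b"
    then have "b \<in> right_composable \<Lambda> D a"
      using same_left_partners_self[OF that(2)] by simp
    then show "(a, b) \<in> D" by (simp add: right_composable_def)
  qed (rule right_composable_eq_same_left_partners[OF assms(1) that])
  then show ?thesis using assms(2) by (auto simp: composable_pairs_def)
qed

context exel_semigroupoid
begin

lemma right_composable_mult:
  assumes "(a, b) \<in> D"
  shows "right_composable \<Lambda> D (a \<odot> b) = right_composable \<Lambda> D b"
proof -
  have "a \<in> \<Lambda>" "b \<in> \<Lambda>" using assms D_subset by auto
  then show ?thesis
    using assms composable_iff_left[of a b] by (auto simp: right_composable_def)
qed

lemma same_left_partners_mult:
  assumes "(a, b) \<in> D"
  shows "same_left_partners \<Lambda> D (a \<odot> b) = same_left_partners \<Lambda> D a"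
proof -
  have "a \<in> \<Lambda>" "b \<in> \<Lambda>" using assms D_subset by auto
  then have "(x, a \<odot> b) \<in> D \<longleftrightarrow> (x, a) \<in> D" if "x \<in> \<Lambda>" for x
    using assms composable_iff_right[OF that, of a b] by blast
  then show ?thesis by (simp add: same_left_partners_def)
qed

lemma graphed_semigroupoid_of_categorical:
  assumes "categorical \<Lambda> D"
  shows "graphed_semigroupoid (right_composable \<Lambda> D ` \<Lambda> \<union> same_left_partners \<Lambda> D ` \<Lambda>) \<Lambda>
    (right_composable \<Lambda> D) (same_left_partners \<Lambda> D) mult"
proof -
  note pairs = composable_pairs_same_left_partners[OF assms D_subset]
  have triples: "(a, b, c) \<in> composable_triples \<Lambda> (right_composable \<Lambda> D) (same_left_partners \<Lambda> D)
      \<Longrightarrow> (a, b) \<in> D \<and> (b, c) \<in> D" for a b c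
    by (subst (1 2) pairs[symmetric])
      (auto simp: composable_pairs_def composable_triples_def)
  show ?thesis
  proof
    fix a b c
    assume "(a, b, c) \<in> composable_triples \<Lambda> (right_composable \<Lambda> D) (same_left_partners \<Lambda> D)"
    from triples[OF this] show "(a \<odot> b) \<odot> c = a \<odot> (b \<odot> c)"
      using D_subset mult_assoc[of a b c] by auto
  qed (auto simp: pairs mult_closed right_composable_mult same_left_partners_mult)
qed

end

theorem theorem2p15:
  shows "(\<forall>(V :: 'v set) (S :: 'a set) src rng mult.
            graphed_semigroupoid V S src rng mult \<longrightarrow>
              exel_semigroupoid S (composable_pairs S src rng) mult \<and>
              categorical S (composable_pairs S src rng)) \<and>
         (\<forall>(\<Lambda> :: 'b set) D mult.
            exel_semigroupoid \<Lambda> D mult \<and> categorical \<Lambda> D \<longrightarrow>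
              (\<exists>(\<Lambda>0 :: 'b set set) src rng.
                 D = composable_pairs \<Lambda> src rng \<and>
                 graphed_semigroupoid \<Lambda>0 \<Lambda> src rng mult))"
proof (intro conjI allI impI)
  fix V :: "'v set" and S :: "'a set" and src rng mult
  assume "graphed_semigroupoid V S src rng mult"
  then show "exel_semigroupoid S (composable_pairs S src rng) mult"
    by (rule graphed_semigroupoid.exel_semigroupoid_composable_pairs)
  show "categorical S (composable_pairs S src rng)"
    by (rule categorical_composable_pairs)
next
  fix \<Lambda> :: "'b set" and D mult
  assume "exel_semigroupoid \<Lambda> D mult \<and> categorical \<Lambda> D"
  then interpret exel_semigroupoid \<Lambda> D mult by simp
  have cat: "categorical \<Lambda> D"
    using \<open>exel_semigroupoid \<Lambda> D mult \<and> categorical \<Lambda> D\<close> by simp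
  show "\<exists>(\<Lambda>0 :: 'b set set) src rng.
      D = composable_pairs \<Lambda> src rng \<and> graphed_semigroupoid \<Lambda>0 \<Lambda> src rng mult"
    using composable_pairs_same_left_partners[OF cat D_subset]
      graphed_semigroupoid_of_categorical[OF cat] by metis
qed

end
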